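(* Let $k_1,k_2,\ell$ be integers with $k_1,k_2\ge 2$ and $\ell\ge k_1+k_2$. Then \[ \frac{\ell!\,(\ell-k_1-k_2)!}{(\ell-k_2)!\,(\ell-k_1)!}\le \overline{M}(k_1,k_2,\ell)<\frac{\ell!\,(\ell-k_1-k_2)!}{(\ell-k_2)!\,(\ell-k_1)!}\,\log\binom{\ell}{k_1}. \]
   Context: $\log$ is the natural logarithm. For positive integers $k_1,k_2,\ell$, a family $\mathcal F$ of $k_2$-element subsets of $[\ell]=\{1,\dots,\ell\}$ has Property A$(k_1,k_2,\ell)$ if there is a $k_1$-element subset of $[\ell]$ intersecting every set in $\mathcal F$; $\overline{M}(k_1,k_2,\ell)$ is the minimum cardinality of a family of $k_2$-element subsets of $[\ell]$ without Property A$(k_1,k_2,\ell)$. *)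

theory Defs
  imports Complex_Main
begin

definition subsets_of_size :: "nat \<Rightarrow> nat \<Rightarrow> nat set set" where
  "subsets_of_size k l = {S. S \<subseteq> {1..l} \<and> card S = k}"

definition property_A :: "nat \<Rightarrow> nat \<Rightarrow> nat set set \<Rightarrow> bool" where
  "property_A k1 l F \<longleftrightarrow> (\<exists>T \<in> subsets_of_size k1 l. \<forall>S \<in> F. T \<inter> S \<noteq> {})"

text \<open>The minimum is attained whenever \<open>k1 \<ge> 1\<close>, \<open>k2 \<ge> 1\<close> and \<open>k1 + k2 \<le> l\<close>, because then
  the family of all \<open>k2\<close>-element subsets lacks property A. If no family lacks
  property A, the value is unspecified.\<close>

definition M_bar :: "nat \<Rightarrow> nat \<Rightarrow> nat \<Rightarrow> nat" where
  "M_bar k1 k2 l =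
     (LEAST m. \<exists>F. F \<subseteq> subsets_of_size k2 l \<and> \<not> property_A k1 l F \<and> card F = m)"

end

theory Submission
  imports Defs
begin

text \<open>A family lacks Property A iff every \<open>k1\<close>-set is missed by some member. A fixed \<open>k2\<close>-set misses
  a proportion \<open>p\<close> of all \<open>k1\<close>-sets, where \<open>1 / p\<close> is the quotient of factorials, so at least
  \<open>1 / p\<close> members are needed. Conversely, choosing the members greedily leaves at most
  \<open>N * (1 - p) ^ m\<close> of the \<open>N = l choose k1\<close> sets after \<open>m\<close> steps. To save the rounding, take the
  largest integer \<open>m < ln N / p\<close>; the inequality \<open>- ln (1 - p) \<ge> 2 * p / (2 - p)\<close> shows that nothing
  is left as soon as \<open>ln N > 2\<close>. The only remaining case is \<open>l = 4\<close>, where all six pairs do.\<close>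

text \<open>By averaging, some \<open>y\<close> is related to at least a proportion \<open>p\<close>
  of the elements not yet covered, so each greedy choice shrinks the uncovered part by a factor of
  at most \<open>1 - p\<close>.\<close>

lemma greedy_cover:
  fixes R :: "'a \<Rightarrow> 'b \<Rightarrow> bool"
  assumes X: "finite X" and Y: "finite Y" "Y \<noteq> {}"
    and deg: "\<And>x. x \<in> X \<Longrightarrow> real (card {y \<in> Y. R x y}) \<ge> p * real (card Y)"
    and p: "p \<le> 1"
  shows "\<exists>F \<subseteq> Y. card F \<le> m \<and> real (card {x \<in> X. \<forall>y \<in> F. \<not> R x y}) \<le> real (card X) * (1 - p) ^ m"
proof (induction m)
  case 0
  show ?case by (rule exI[of _ "{}"]) simp
next
  case (Suc m)
  then obtain F where F: "F \<subseteq> Y" "card F \<le> m"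
    and le: "real (card {x \<in> X. \<forall>y \<in> F. \<not> R x y}) \<le> real (card X) * (1 - p) ^ m"
    by blast
  define U where "U = {x \<in> X. \<forall>y \<in> F. \<not> R x y}"
  have U: "finite U" "U \<subseteq> X" using X by (auto simp: U_def)
  \<comment> \<open>Otherwise counting the related pairs in \<open>U\<close> and \<open>Y\<close> by
    \<open>y\<close> gives less than \<open>p * card U * card Y\<close>, while counting them by
    \<open>x\<close> gives at least that much.\<close>
  have "\<exists>y\<in>Y. real (card {x \<in> U. R x y}) \<ge> p * real (card U)"
  proof (rule ccontr)
    assume "\<not> ?thesis"
    then have "(\<Sum>y\<in>Y. real (card {x \<in> U. R x y})) < (\<Sum>y\<in>Y. p * real (card U))"
      using Y by (intro sum_strict_mono) (auto simp: not_le)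
    also have "\<dots> = (\<Sum>x\<in>U. p * real (card Y))" by simp
    also have "\<dots> \<le> (\<Sum>x\<in>U. real (card {y \<in> Y. R x y}))"
      using U deg by (intro sum_mono) auto
    also have "\<dots> = (\<Sum>y\<in>Y. real (card {x \<in> U. R x y}))"
      using sum.swap_restrict[OF U(1) Y(1), of "\<lambda>_ _. 1::real" R] by simp
    finally show False by simp
  qed
  then obtain y where y: "y \<in> Y" "real (card {x \<in> U. R x y}) \<ge> p * real (card U)" by blast
  have "{x \<in> X. \<forall>y \<in> insert y F. \<not> R x y} = U - {x \<in> U. R x y}" by (auto simp: U_def)
  then have "real (card {x \<in> X. \<forall>y \<in> insert y F. \<not> R x y}) = real (card U) - real (card {x \<in> U. R x y})"
    using U by (simp add: card_Diff_subset card_mono of_nat_diff)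
  also have "\<dots> \<le> (1 - p) * real (card U)" using y by (simp add: algebra_simps)
  also have "\<dots> \<le> (1 - p) * (real (card X) * (1 - p) ^ m)"
    using le p by (intro mult_left_mono) (auto simp: U_def)
  finally have "real (card {x \<in> X. \<forall>y \<in> insert y F. \<not> R x y}) \<le> real (card X) * (1 - p) ^ Suc m"
    by (simp add: mult_ac)
  moreover have "card (insert y F) \<le> Suc m"
    using F by (metis Suc_le_mono card_insert_le_m1 diff_Suc_1 zero_less_Suc)
  ultimately show ?case using F y by (intro exI[of _ "insert y F"]) auto
qed

lemma finite_subsets_of_size [simp]: "finite (subsets_of_size k l)"
  by (simp add: subsets_of_size_def)

lemma card_subsets_of_size [simp]: "card (subsets_of_size k l) = l choose k"
  using n_subsets[of "{1..l}" k] by (simp add: subsets_of_size_def)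

lemma card_disjoint_subsets_of_size:
  assumes "T \<in> subsets_of_size j l"
  shows "card {S \<in> subsets_of_size k l. T \<inter> S = {}} = (l - j) choose k"
proof -
  have "{S \<in> subsets_of_size k l. T \<inter> S = {}} = {S. S \<subseteq> {1..l} - T \<and> card S = k}"
    by (auto simp: subsets_of_size_def)
  moreover have "card ({1..l} - T) = l - j"
    using assms by (auto simp: subsets_of_size_def card_Diff_subset finite_subset)
  ultimately show ?thesis using n_subsets[of "{1..l} - T" k] by simp
qed

lemma not_property_A_iff:
  "\<not> property_A j l F \<longleftrightarrow> {T \<in> subsets_of_size j l. \<forall>S \<in> F. T \<inter> S \<noteq> {}} = {}"
  by (auto simp: property_A_def)

text \<open>Outside a \<open>j\<close>-set at least \<open>k\<close> points remain, enough for a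
  \<open>k\<close>-set that misses it. Hence the minimum in \<open>M_bar\<close> is taken over a
  nonempty set.\<close>

lemma not_property_A_all:
  assumes "j + k \<le> l"
  shows "\<not> property_A j l (subsets_of_size k l)"
proof
  assume "property_A j l (subsets_of_size k l)"
  then obtain T where T: "T \<in> subsets_of_size j l" "{S \<in> subsets_of_size k l. T \<inter> S = {}} = {}"
    unfolding property_A_def by blast
  then have "(l - j) choose k = 0"
    using card_disjoint_subsets_of_size[OF T(1), of k] by (metis card.empty)
  with assms show False by simp
qed

lemma M_bar_le:
  assumes "F \<subseteq> subsets_of_size k l" "\<not> property_A j l F"
  shows "M_bar j k l \<le> card F"
  unfolding M_bar_def using assms by (intro Least_le) auto

lemma M_bar_attained:
  assumes "j + k \<le> l"
  obtains F where "F \<subseteq> subsets_of_size k l" "\<not> property_A j l F" "card F = M_bar j k l"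
proof -
  have "\<exists>m F. F \<subseteq> subsets_of_size k l \<and> \<not> property_A j l F \<and> card F = m"
    using not_property_A_all[OF assms] by blast
  from LeastI_ex[OF this] show ?thesis using that unfolding M_bar_def by blast
qed

text \<open>Union bound: every \<open>j\<close>-set is missed by some member of \<open>F\<close>,
  and each member misses exactly \<open>(l - k) choose j\<close> of them.\<close>

lemma card_ge_if_not_property_A:
  assumes "F \<subseteq> subsets_of_size k l" "\<not> property_A j l F"
  shows "l choose j \<le> card F * ((l - k) choose j)"
proof -
  have fin: "finite F" using assms(1) finite_subset finite_subsets_of_size by blast
  have "subsets_of_size j l = (\<Union>S\<in>F. {T \<in> subsets_of_size j l. S \<inter> T = {}})"
    using assms(2) by (auto simp: property_A_def Int_commute)
  then have "l choose j = card (\<Union>S\<in>F. {T \<in> subsets_of_size j l. S \<inter> T = {}})"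
    using card_subsets_of_size by metis
  also have "\<dots> \<le> (\<Sum>S\<in>F. card {T \<in> subsets_of_size j l. S \<inter> T = {}})"
    by (rule card_UN_le[OF fin])
  also have "\<dots> = (\<Sum>S\<in>F. (l - k) choose j)"
    using assms(1) by (intro sum.cong refl card_disjoint_subsets_of_size) auto
  finally show ?thesis by simp
qed

text \<open>The right-hand side is symmetric in \<open>j\<close> and \<open>k\<close>, so the
  quotient on the left keeps its value when they are exchanged.\<close>

lemma binomial_quotient_fact:
  assumes "j + k \<le> l"
  shows "real (l choose j) / real ((l - k) choose j)
    = (fact l * fact (l - j - k)) / (fact (l - k) * fact (l - j))"
proof -
  have "l - k - j = l - j - k" by simp
  then show ?thesis using assms by (simp add: binomial_fact field_simps)
qed

text \<open>The bound expands as \<open>p + p^2 / 2 + ...\<close>; its gain over the usual bound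
  \<open>p\<close> pays for rounding the number of greedy steps down.\<close>

lemma neg_ln_one_minus_ge:
  fixes p :: real
  assumes "0 \<le> p" "p < 1"
  shows "- ln (1 - p) \<ge> 2 * p / (2 - p)"
proof -
  define g where "g = (\<lambda>t::real. - (2 - t) * ln (1 - t) - 2 * t)"
  have "g 0 \<le> g p"
  proof (rule DERIV_nonneg_imp_nondecreasing[OF assms(1)])
    fix t assume t: "0 \<le> t" "t \<le> p"
    then have t1: "t < 1" using assms by simp
    have "(g has_real_derivative (ln (1 - t) + (2 - t) / (1 - t) - 2)) (at t)"
      unfolding g_def using t1 by (auto intro!: derivative_eq_intros simp: divide_inverse algebra_simps)
    moreover have "ln (1 - t) + (2 - t) / (1 - t) - 2 \<ge> 0"
    proof -
      \<comment> \<open>With \<open>x = 1 / (1 - t)\<close> the derivative is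
        \<open>x - 1 - ln x\<close>.\<close>
      have "ln (inverse (1 - t)) \<le> inverse (1 - t) - 1" using t1 by (intro ln_le_minus_one) simp
      moreover have "(2 - t) / (1 - t) = inverse (1 - t) + 1" using t1 by (simp add: field_simps)
      ultimately show ?thesis using t1 by (simp add: ln_inverse)
    qed
    ultimately show "\<exists>d. (g has_real_derivative d) (at t) \<and> 0 \<le> d" by blast
  qed
  then have "2 * p \<le> - ln (1 - p) * (2 - p)" by (simp add: g_def algebra_simps)
  then show ?thesis using assms by (simp add: divide_le_eq)
qed

text \<open>Pascal's rule, starting from the entries 10 and 10 of row 5: in each later row at least
  one of the two summands lies in the range of the induction hypothesis.\<close>

lemma binomial_ge_10:
  assumes "5 \<le> l" "2 \<le> k" "k + 2 \<le> l"
  shows "10 \<le> l choose k"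
  using assms
proof (induction l arbitrary: k rule: dec_induct)
  case base
  then have "k = 2 \<or> k = 3" by auto
  then show ?case by (auto simp: numeral_eq_Suc)
next
  case (step l)
  obtain i where i: "k = Suc i" using step.prems by (cases k) auto
  show ?case
  proof (cases "k + 2 \<le> l")
    case True
    then show ?thesis using step.IH[of k] step.prems i by simp
  next
    case False
    then show ?thesis using step.IH[of i] step.prems step.hyps i by simp
  qed
qed

lemma M_bar_less:
  fixes j k l :: nat
  defines "Q \<equiv> real (l choose j) / real ((l - k) choose j)"
  assumes jk: "j + k \<le> l" and j: "j \<ge> 1" and k: "k \<ge> 1" and ln: "ln (real (l choose j)) > 2"
  shows "real (M_bar j k l) < Q * ln (real (l choose j))"
proof -
  define L where "L = ln (real (l choose j))"
  define p where "p = 1 / Q"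
  \<comment> \<open>Ceiling minus one rather than floor keeps \<open>m < Q * L\<close> strict even
    if \<open>Q * L\<close> is an integer.\<close>
  define m where "m = nat (\<lceil>Q * L\<rceil> - 1)"
  have pos: "(l choose j) > 0" "((l - k) choose j) > 0" "(l choose k) > 0" "((l - j) choose k) > 0"
    using jk by auto
  have less: "((l - k) choose j) < (l choose j)"
  proof -
    obtain i where i: "j = Suc i" using j by (cases j) auto
    obtain n where n: "l = Suc n" using jk j by (cases l) auto
    have "(l - k) choose j \<le> n choose j" using n k by (intro binomial_right_mono) simp
    moreover have "n choose i > 0" using jk i n by simp
    ultimately have "(l - k) choose j < (n choose i) + (n choose j)" by linarith
    then show ?thesis unfolding i n by simp
  qed
  have p: "0 < p" "p < 1" using pos less by (auto simp: p_def Q_def)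
  have L: "L > 2" using ln by (simp add: L_def)
  have QL: "Q * L = L / p" by (simp add: p_def)
  have QLpos: "Q * L > 0" using p L by (simp add: QL)
  have m: "real m < Q * L" "real m \<ge> Q * L - 1"
    using QLpos by (simp_all add: m_def) linarith+
  \<comment> \<open>By the symmetry of the factorial quotient, \<open>p\<close> is also the
    proportion of \<open>k\<close>-sets that miss a fixed \<open>j\<close>-set, which is the degree
    condition of the greedy argument.\<close>
  have "real ((l - j) choose k) = p * real (l choose k)"
  proof -
    have "real (l choose k) / real ((l - j) choose k) = Q"
      using binomial_quotient_fact[of k j l] binomial_quotient_fact[of j k l] jk
      by (simp add: Q_def mult_ac add.commute diff_right_commute)
    moreover have "Q > 0" using p by (simp add: p_def)
    ultimately show ?thesis using pos by (simp add: p_def field_simps)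
  qed
  then have deg: "real (card {S \<in> subsets_of_size k l. T \<inter> S = {}}) \<ge> p * real (card (subsets_of_size k l))"
    if "T \<in> subsets_of_size j l" for T
    using card_disjoint_subsets_of_size[OF that, of k] by simp
  have ne: "subsets_of_size k l \<noteq> {}"
    using pos(3) card_subsets_of_size[of k l] by (metis card.empty less_irrefl)
  obtain F where F: "F \<subseteq> subsets_of_size k l" "card F \<le> m"
    "real (card {T \<in> subsets_of_size j l. \<forall>S\<in>F. T \<inter> S \<noteq> {}}) \<le> real (l choose j) * (1 - p) ^ m"
    using greedy_cover[of "subsets_of_size j l" "subsets_of_size k l" p "\<lambda>T S. T \<inter> S = {}" m]
      deg ne p by auto
  have "L < real m * - ln (1 - p)"
  proof -
    \<comment> \<open>This is equivalent to \<open>2 * p < L * p\<close>, which is where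
      \<open>L > 2\<close> enters.\<close>
    have "L * (2 - p) < 2 * (L - p)" using L p by (simp add: algebra_simps)
    then have "L < 2 * (L - p) / (2 - p)" using p by (simp add: less_divide_eq)
    also have "\<dots> = (L / p - 1) * (2 * p / (2 - p))" using p by (simp add: field_simps)
    also have "\<dots> \<le> real m * - ln (1 - p)"
      using m p neg_ln_one_minus_ge[of p] by (intro mult_mono) (auto simp: QL)
    finally show ?thesis .
  qed
  then have "ln (real (l choose j) * (1 - p) ^ m) < 0"
    using p pos by (simp add: ln_mult ln_realpow L_def)
  then have "real (l choose j) * (1 - p) ^ m < 1"
    using p pos by (subst (asm) ln_less_zero_iff) auto
  \<comment> \<open>A natural number below 1 is 0.\<close>
  with F(3) have "card {T \<in> subsets_of_size j l. \<forall>S\<in>F. T \<inter> S \<noteq> {}} = 0" by linarith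
  then have "\<not> property_A j l F"
    unfolding not_property_A_iff by (subst (asm) card_0_eq) simp_all
  then have "M_bar j k l \<le> m" using M_bar_le[OF F(1)] F(2) by (meson le_trans)
  with m(1) show ?thesis unfolding L_def by linarith
qed

theorem theorem4p2:
  fixes k1 k2 l :: nat
  assumes "k1 \<ge> 2" and "k2 \<ge> 2" and "l \<ge> k1 + k2"
  shows "(fact l * fact (l - k1 - k2)) / (fact (l - k2) * fact (l - k1)) \<le> real (M_bar k1 k2 l)
       \<and> real (M_bar k1 k2 l)
           < (fact l * fact (l - k1 - k2)) / (fact (l - k2) * fact (l - k1)) * ln (real (l choose k1))"
proof -
  define Q where "Q = real (l choose k1) / real ((l - k2) choose k1)"
  have Q: "(fact l * fact (l - k1 - k2)) / (fact (l - k2) * fact (l - k1)) = Q"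
    using binomial_quotient_fact[OF assms(3)] by (simp add: Q_def)
  have "Q \<le> real (M_bar k1 k2 l)"
  proof -
    obtain F where F: "F \<subseteq> subsets_of_size k2 l" "\<not> property_A k1 l F" "card F = M_bar k1 k2 l"
      using M_bar_attained[OF assms(3)] .
    have "real (l choose k1) \<le> real (M_bar k1 k2 l) * real ((l - k2) choose k1)"
      using card_ge_if_not_property_A[OF F(1,2)] unfolding F(3) of_nat_mult[symmetric] of_nat_le_iff .
    moreover have "(l - k2) choose k1 > 0" using assms by simp
    ultimately show ?thesis by (simp add: Q_def divide_le_eq)
  qed
  moreover have "real (M_bar k1 k2 l) < Q * ln (real (l choose k1))"
  proof (cases "l = 4")
    case True
    then have k: "k1 = 2" "k2 = 2" using assms by auto
    have six: "(4::nat) choose 2 = 6" by (simp add: numeral_eq_Suc)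
    \<comment> \<open>Here \<open>Q = 6 / 1\<close>, so the claim follows from
      \<open>6 < 6 * ln 6\<close>; \<open>M_bar_less\<close> does not apply because
      \<open>ln 6 < 2\<close>.\<close>
    have "M_bar 2 2 4 \<le> 6"
      using M_bar_le[OF order_refl not_property_A_all[of 2 2 4]] six by simp
    moreover have "ln (6::real) > 1" using exp_le ln_less_cancel_iff[of "exp 1" "6::real"] by simp
    ultimately show ?thesis using True k six by (simp add: Q_def)
  next
    case False
    then have "10 \<le> l choose k1" using assms by (intro binomial_ge_10) auto
    \<comment> \<open>Squaring \<open>exp 1 \<le> 3\<close> leaves room below 10.\<close>
    moreover have "exp (2::real) \<le> 9"
      using mult_mono[OF exp_le exp_le] by (simp flip: exp_add)
    ultimately have "exp 2 < real (l choose k1)" by linarith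
    then have "ln (real (l choose k1)) > 2"
      by (metis exp_gt_zero ln_exp ln_less_cancel_iff order.strict_trans)
    then show ?thesis unfolding Q_def using assms by (intro M_bar_less) auto
  qed
  ultimately show ?thesis unfolding Q by blast
qed

end
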